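(* Let $G$ be a finitely generated group with an epimorphism $h:G\to\mathbb{Z}$ onto the infinite cyclic group. Consider a finite generating set $S$ of $G$ of the form $S=\{t\}\cup K$ such that $h(t)$ generates $\mathbb{Z}$ and $K\subset \mathrm{Ker}(h)$. Then the combinatorial Laplace operator on the Cayley graph of $G$ with respect to $S$ has no eigenfunction with finite support. If moreover $G$ is amenable, then the combinatorial Laplace operator on the Cayley graph of $G$ with respect to $S$ has no eigenfunction.
   Context: Cayley graph: for a group $G$ and a (not necessarily symmetric) generating set $S\subset G$, the Cayley graph $\mathcal{C}(G,S)$ has vertex set $V=G$ and oriented edge set $E=(G\times S)\sqcup\overline{(G\times S)}$, where the edge $(g,s)$ has origin $g$ and terminus $gs$, and the reversed edge $\overline{(g,s)}$ has origin $gs$ and terminus $g$ (loops and multiple edges are allowed). So for $S$ finite each vertex is the origin of exactly $2|S|$ oriented edges. Combinatorial Laplacian: for a graph with oriented edge set $E$, origin and terminus maps $o,t$, and $E_x=\{e\in E: o(e)=x\}$, it is $\Delta\varphi(x)=\varphi(x)-\frac{1}{|E_x|}\sum_{e\in E_x}\varphi(t(e))$. On $\mathcal{C}(G,S)$ with $S$ finite it is the bounded self-adjoint operator on $l^2(G)$ (counting measure, complex valued functions) $$\Delta\varphi(g)=\varphi(g)-\frac{1}{2|S|}\sum_{s\in S}\left(\varphi(gs)+\varphi(gs^{-1})\right).$$ Eigenvalues and eigenfunctions are always understood in the $l^2$ sense: an eigenfunction is a nonzero $\varphi\in l^2(G)$ with $\Delta\varphi=\lambda\varphi$ for some $\lambda\in\mathbb{R}$.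 *)

theory Defs
  imports
    "HOL-Analysis.Analysis"
    "HOL-Algebra.Elementary_Groups"
    "Graph_Theory.Digraph"
begin

text \<open>
  A graph is given by its oriented edges: the arcs of a \<open>pre_digraph\<close>, with \<open>tail\<close> the origin map,
  \<open>head\<close> the terminus map and \<open>out_arcs X x\<close> the set \<open>E\<^sub>x\<close> of edges with origin \<open>x\<close>.
  In the Cayley graph, \<open>Inl (g, s)\<close> is the edge \<open>(g, s)\<close> and \<open>Inr (g, s)\<close> is its reverse.
\<close>

definition cayley_graph ::
  "('a, 'm) monoid_scheme \<Rightarrow> 'a set \<Rightarrow> ('a, 'a \<times> 'a + 'a \<times> 'a) pre_digraph" where
  "cayley_graph G S =
    \<lparr> verts = carrier G,
      arcs = Inl ` (carrier G \<times> S) \<union> Inr ` (carrier G \<times> S),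
      tail = case_sum (\<lambda>(g, s). g) (\<lambda>(g, s). g \<otimes>\<^bsub>G\<^esub> s),
      head = case_sum (\<lambda>(g, s). g \<otimes>\<^bsub>G\<^esub> s) (\<lambda>(g, s). g) \<rparr>"

definition laplacian :: "('v, 'e) pre_digraph \<Rightarrow> ('v \<Rightarrow> complex) \<Rightarrow> 'v \<Rightarrow> complex" where
  "laplacian X \<phi> x = \<phi> x - (1 / of_nat (card (out_arcs X x))) * (\<Sum>e\<in>out_arcs X x. \<phi> (head X e))"

definition square_summable_on :: "('v \<Rightarrow> complex) \<Rightarrow> 'v set \<Rightarrow> bool" where
  "square_summable_on \<phi> V \<longleftrightarrow> (\<lambda>x. (cmod (\<phi> x))\<^sup>2) summable_on V"

text \<open>Only the values on the vertex set matter; in particular \<open>\<phi>\<close> must be nonzero there.\<close>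

definition laplace_eigenfunction ::
  "('v, 'e) pre_digraph \<Rightarrow> real \<Rightarrow> ('v \<Rightarrow> complex) \<Rightarrow> bool" where
  "laplace_eigenfunction X \<nu> \<phi> \<longleftrightarrow>
    square_summable_on \<phi> (verts X) \<and>
    (\<exists>x\<in>verts X. \<phi> x \<noteq> 0) \<and>
    (\<forall>x\<in>verts X. laplacian X \<phi> x = of_real \<nu> * \<phi> x)"

text \<open>
  Amenability of a discrete group in von Neumann's sense: there is a finitely additive,
  left-invariant probability measure defined on all subsets.
\<close>

definition amenable :: "('a, 'm) monoid_scheme \<Rightarrow> bool" where
  "amenable G \<longleftrightarrow>
    (\<exists>\<mu> :: 'a set \<Rightarrow> real.
      (\<forall>A \<subseteq> carrier G. 0 \<le> \<mu> A) \<and>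
      \<mu> (carrier G) = 1 \<and>
      (\<forall>A \<subseteq> carrier G. \<forall>B \<subseteq> carrier G. A \<inter> B = {} \<longrightarrow> \<mu> (A \<union> B) = \<mu> A + \<mu> B) \<and>
      (\<forall>g \<in> carrier G. \<forall>A \<subseteq> carrier G. \<mu> (g <#\<^bsub>G\<^esub> A) = \<mu> A))"

lemma laplacian_cayley_graph:
  assumes "group G" "finite S" "S \<subseteq> carrier G" "g \<in> carrier G"
  shows "laplacian (cayley_graph G S) \<phi> g =
    \<phi> g - (1 / (2 * of_nat (card S))) *
      (\<Sum>s\<in>S. \<phi> (g \<otimes>\<^bsub>G\<^esub> s) + \<phi> (g \<otimes>\<^bsub>G\<^esub> inv\<^bsub>G\<^esub> s))"
proof -
  interpret group G by fact
  let ?i = "\<lambda>s. Inl (g, s) :: 'a \<times> 'a + 'a \<times> 'a"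
  let ?j = "\<lambda>s. Inr (g \<otimes>\<^bsub>G\<^esub> inv\<^bsub>G\<^esub> s, s) :: 'a \<times> 'a + 'a \<times> 'a"
  have eq: "out_arcs (cayley_graph G S) g = ?i ` S \<union> ?j ` S" (is "?L = ?R")
  proof (intro equalityI subsetI)
    fix e assume "e \<in> ?L"
    then show "e \<in> ?R"
      using assms by (auto simp: out_arcs_def cayley_graph_def image_iff m_assoc subset_iff)
  next
    fix e assume "e \<in> ?R"
    then show "e \<in> ?L"
      using assms by (auto simp: out_arcs_def cayley_graph_def m_assoc subset_iff)
  qed
  have inj: "inj_on ?i S" "inj_on ?j S" by (auto simp: inj_on_def)
  have disj: "?i ` S \<inter> ?j ` S = {}" by auto
  have "card ?R = 2 * card S"
    using assms disj by (simp add: card_Un_disjoint card_image inj)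
  moreover have "(\<Sum>e\<in>?R. \<phi> (head (cayley_graph G S) e)) =
      (\<Sum>s\<in>S. \<phi> (g \<otimes>\<^bsub>G\<^esub> s) + \<phi> (g \<otimes>\<^bsub>G\<^esub> inv\<^bsub>G\<^esub> s))"
    using assms disj
    by (simp add: sum.union_disjoint sum.reindex inj sum.distrib cayley_graph_def)
  ultimately show ?thesis
    unfolding laplacian_def eq by simp
qed

end

theory Submission
  imports Defs
begin

text \<open>
  After multiplying \<open>h\<close> by a sign, \<open>h t = 1\<close>. Right multiplication by \<open>t\<close> then raises the level
  \<open>h\<close> by one and right multiplication by an element of \<open>K\<close> preserves it, so the eigenvalue equation at
  level \<open>k\<close> expresses the values on level \<open>k + 1\<close> through those on the levels \<open>k\<close> and \<open>k - 1\<close>, and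
  symmetrically downwards. Hence an eigenfunction is determined by its restriction to the two levels
  \<open>0\<close> and \<open>1\<close> (\<open>eigen_determined_by_two_levels\<close>). Both claims follow once the eigenspace \<open>H\<close> in
  \<open>\<ell>\<^sup>2(G)\<close> is shown to be zero (\<open>eigenspace_trivial\<close>). As the eigenvalue is real, real and imaginary
  parts can be treated separately, and the argument takes place in a real Hilbert space.

  The reason for \<open>H = 0\<close> is a count of von Neumann dimensions over the group \<open>N = ker h\<close>, which acts by
  left translations. Restriction embeds \<open>H\<close> into the functions on two levels, that is into two
  copies of \<open>\<ell>\<^sup>2(N)\<close>, so \<open>H\<close> has dimension at most \<open>2\<close> over \<open>N\<close>. On the other hand \<open>H\<close> is invariant
  under all of \<open>G\<close>, so each of the infinitely many levels contributes the same amount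
  \<open>d = \<parallel>P \<delta>\<^sub>g\<parallel>\<^sup>2\<close> to this dimension, where \<open>P\<close> is the orthogonal projection onto \<open>H\<close>. Therefore
  \<open>d = 0\<close>, and then \<open>u g = \<langle>u, P \<delta>\<^sub>g\<rangle> = 0\<close> for every \<open>u\<close> in \<open>H\<close>.

  The dimension count is carried out by hand, with a constant \<open>4\<close> in place of \<open>2\<close>. Let \<open>E\<close> be the
  restriction to the levels \<open>0\<close> and \<open>1\<close> and \<open>D\<^sub>l = (P (1 - E) P)\<^sup>l P\<close>, the alternating
  projections onto \<open>H\<close> and the kernel of \<open>E\<close>. These two subspaces meet in \<open>0\<close>, so \<open>D\<^sub>l u\<close> tends to \<open>0\<close>
  along even \<open>l\<close> (\<open>iter_tendsto_0\<close>). The squared norm lost at step \<open>l\<close> is at most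
  \<open>2 \<parallel>E D\<^sub>l u\<parallel>\<^sup>2\<close> (\<open>energy_loss\<close>). The trace identity \<open>level_transport\<close> bounds the sum of these losses over
  \<open>u = \<delta>\<^sub>x\<close>, with \<open>x\<close> running through powers of \<open>t\<close>, by the sum of \<open>2 \<parallel>D\<^sub>l \<delta>\<^sub>y\<parallel>\<^sup>2\<close> over the two points
  \<open>y = 1, t\<close>, and for those the sum over \<open>l\<close> of \<open>\<parallel>D\<^sub>l \<delta>\<^sub>y\<parallel>\<^sup>2\<close> is at most \<open>1\<close> (\<open>energy_bound\<close>). So the
  total loss \<open>n d\<close> of any \<open>n\<close> levels is at most \<open>4\<close>.
\<close>

section \<open>The Hilbert space of square summable functions\<close>

lemma summable_on_square_add:
  fixes f g :: "'a \<Rightarrow> real"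
  assumes "(\<lambda>x. (f x)\<^sup>2) summable_on A" "(\<lambda>x. (g x)\<^sup>2) summable_on A"
  shows "(\<lambda>x. (f x + g x)\<^sup>2) summable_on A"
proof (rule summable_on_comparison_test)
  show "(\<lambda>x. 2 * (f x)\<^sup>2 + 2 * (g x)\<^sup>2) summable_on A"
    using assms by (intro summable_on_add summable_on_cmult_right)
  show "(f x + g x)\<^sup>2 \<le> 2 * (f x)\<^sup>2 + 2 * (g x)\<^sup>2" for x
    using sum_squares_bound[of "f x" "g x"] by (simp add: power2_sum)
qed simp

lemma summable_on_square_mult:
  fixes f g :: "'a \<Rightarrow> real"
  assumes "(\<lambda>x. (f x)\<^sup>2) summable_on A" "(\<lambda>x. (g x)\<^sup>2) summable_on A"
  shows "(\<lambda>x. f x * g x) summable_on A"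
proof -
  have "(\<lambda>x. ((f x + g x)\<^sup>2 + - (f x)\<^sup>2 + - (g x)\<^sup>2) * (1 / 2)) summable_on A"
    using assms
    by (intro summable_on_cmult_left summable_on_add summable_on_square_add)
       (simp_all add: summable_on_uminus)
  then show ?thesis by (simp add: power2_sum)
qed

text \<open>
  The index set is a whole type; functions on the carrier of a group appear below as the closed
  subspace of functions that vanish off the carrier.
\<close>

typedef 'a ell2 = "{f :: 'a \<Rightarrow> real. (\<lambda>x. (f x)\<^sup>2) summable_on UNIV}"
  by (rule exI[of _ "\<lambda>_. 0"]) simp

setup_lifting type_definition_ell2

instantiation ell2 :: (type) real_inner
begin

lift_definition zero_ell2 :: "'a ell2" is "\<lambda>_. 0" by simp

lift_definition uminus_ell2 :: "'a ell2 \<Rightarrow> 'a ell2" is "\<lambda>f x. - f x" by simp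

lift_definition plus_ell2 :: "'a ell2 \<Rightarrow> 'a ell2 \<Rightarrow> 'a ell2" is "\<lambda>f g x. f x + g x"
  by (rule summable_on_square_add)

lift_definition minus_ell2 :: "'a ell2 \<Rightarrow> 'a ell2 \<Rightarrow> 'a ell2" is "\<lambda>f g x. f x - g x"
  subgoal for f g using summable_on_square_add[of f UNIV "\<lambda>x. - g x"] by simp
  done

lift_definition scaleR_ell2 :: "real \<Rightarrow> 'a ell2 \<Rightarrow> 'a ell2" is "\<lambda>r f x. r * f x"
  unfolding power_mult_distrib by (rule summable_on_cmult_right)

lift_definition inner_ell2 :: "'a ell2 \<Rightarrow> 'a ell2 \<Rightarrow> real" is
  "\<lambda>f g. \<Sum>\<^sub>\<infinity>x. f x * g x" .

definition norm_ell2 :: "'a ell2 \<Rightarrow> real" where "norm_ell2 u = sqrt (inner u u)"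
definition dist_ell2 :: "'a ell2 \<Rightarrow> 'a ell2 \<Rightarrow> real" where "dist_ell2 u v = norm (u - v)"
definition sgn_ell2 :: "'a ell2 \<Rightarrow> 'a ell2" where "sgn_ell2 u = inverse (norm u) *\<^sub>R u"
definition uniformity_ell2 :: "('a ell2 \<times> 'a ell2) filter" where
  "uniformity_ell2 = (INF e\<in>{0<..}. principal {(u, v). dist u v < e})"
definition open_ell2 :: "'a ell2 set \<Rightarrow> bool" where
  "open_ell2 U \<longleftrightarrow> (\<forall>x\<in>U. \<forall>\<^sub>F (x', y) in uniformity. x' = x \<longrightarrow> y \<in> U)"

instance
proof
  fix u v w :: "'a ell2" and r s :: real
  show "u + v + w = u + (v + w)" "u + v = v + u" "0 + u = u" "- u + u = 0" "u - v = u + - v"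
    "r *\<^sub>R (u + v) = r *\<^sub>R u + r *\<^sub>R v" "(r + s) *\<^sub>R u = r *\<^sub>R u + s *\<^sub>R u"
    "r *\<^sub>R s *\<^sub>R u = (r * s) *\<^sub>R u" "1 *\<^sub>R u = u"
    by (transfer; simp add: algebra_simps)+
  show "inner u v = inner v u" by transfer (simp add: mult.commute)
  show "inner (u + v) w = inner u w + inner v w"
    by transfer (simp add: distrib_right infsum_add summable_on_square_mult)
  show "inner (r *\<^sub>R u) v = r * inner u v"
    by transfer (simp add: mult.assoc infsum_cmult_right')
  show "0 \<le> inner u u" by transfer (rule infsum_nonneg, simp)
  show "inner u u = 0 \<longleftrightarrow> u = 0"
  proof
    assume "inner u u = 0"
    then have *: "(\<Sum>\<^sub>\<infinity>x. (Rep_ell2 u x)\<^sup>2) = 0"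
      unfolding inner_ell2.rep_eq power2_eq_square .
    have "Rep_ell2 u x = 0" for x
      using nonneg_infsum_le_0D[OF eq_refl[OF *], of x] Rep_ell2[of u] by simp
    then show "u = 0"
      by (simp add: Rep_ell2_inject[symmetric] zero_ell2.rep_eq fun_eq_iff)
  qed (simp add: inner_ell2.rep_eq zero_ell2.rep_eq)
  show "dist u v = norm (u - v)" by (fact dist_ell2_def)
  show "sgn u = inverse (norm u) *\<^sub>R u" by (fact sgn_ell2_def)
  show "uniformity = (INF e\<in>{0<..}. principal {(u :: 'a ell2, v). dist u v < e})"
    by (fact uniformity_ell2_def)
  show "open U \<longleftrightarrow> (\<forall>x\<in>U. \<forall>\<^sub>F (x', y) in uniformity. x' = x \<longrightarrow> y \<in> U)" for U :: "'a ell2 set"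
    by (fact open_ell2_def)
  show "norm u = sqrt (inner u u)" by (fact norm_ell2_def)
qed

end

lemmas Rep_ell2_simps [simp] =
  zero_ell2.rep_eq plus_ell2.rep_eq minus_ell2.rep_eq uminus_ell2.rep_eq scaleR_ell2.rep_eq

lemma Rep_ell2_square_summable: "(\<lambda>x. (Rep_ell2 u x)\<^sup>2) summable_on A"
  using Rep_ell2[of u] by (auto intro: summable_on_subset_banach)

lemma ell2_norm_square: "(norm u)\<^sup>2 = (\<Sum>\<^sub>\<infinity>x. (Rep_ell2 u x)\<^sup>2)"
  unfolding power2_norm_eq_inner inner_ell2.rep_eq by (simp add: power2_eq_square)

lemma sum_square_le_ell2_norm:
  "finite F \<Longrightarrow> (\<Sum>x\<in>F. (Rep_ell2 u x)\<^sup>2) \<le> (norm u)\<^sup>2"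
  unfolding ell2_norm_square
  by (rule finite_sum_le_infsum[OF Rep_ell2_square_summable]) auto

lemma abs_Rep_ell2_le_norm: "\<bar>Rep_ell2 u x\<bar> \<le> norm u"
  using sum_square_le_ell2_norm[of "{x}" u] by (simp add: abs_le_square_iff[symmetric])

text \<open>
  A Cauchy sequence converges pointwise. Its Cauchy estimates pass to the pointwise limit on each
  finite set, which is all that the norm sees.
\<close>

instance ell2 :: (type) complete_space
proof
  fix X :: "nat \<Rightarrow> 'a ell2"
  assume X: "Cauchy X"
  have "Cauchy (\<lambda>n. Rep_ell2 (X n) x)" for x
  proof (rule metric_CauchyI)
    fix e :: real assume "0 < e"
    then obtain M where M: "\<forall>m\<ge>M. \<forall>n\<ge>M. dist (X m) (X n) < e"
      using metric_CauchyD[OF X] by blast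
    have "dist (Rep_ell2 (X m) x) (Rep_ell2 (X n) x) \<le> dist (X m) (X n)" for m n
      using abs_Rep_ell2_le_norm[of "X m - X n" x] by (simp add: dist_norm)
    then show "\<exists>M. \<forall>m\<ge>M. \<forall>n\<ge>M. dist (Rep_ell2 (X m) x) (Rep_ell2 (X n) x) < e"
      using M by (meson le_less_trans)
  qed
  then have "\<forall>x. \<exists>l. (\<lambda>n. Rep_ell2 (X n) x) \<longlonglongrightarrow> l"
    unfolding Cauchy_convergent_iff convergent_def by blast
  then obtain f where f: "\<And>x. (\<lambda>n. Rep_ell2 (X n) x) \<longlonglongrightarrow> f x"
    using choice by meson
  have tail: "\<exists>M. \<forall>n\<ge>M. \<forall>F. finite F \<longrightarrow> (\<Sum>x\<in>F. (Rep_ell2 (X n) x - f x)\<^sup>2) \<le> e\<^sup>2"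
    if "0 < e" for e :: real
  proof -
    obtain M where M: "\<forall>m\<ge>M. \<forall>n\<ge>M. norm (X m - X n) < e"
      using metric_CauchyD[OF X \<open>0 < e\<close>] unfolding dist_norm by blast
    have "(\<Sum>x\<in>F. (Rep_ell2 (X n) x - f x)\<^sup>2) \<le> e\<^sup>2" if "M \<le> n" "finite F" for n F
    proof (rule Lim_bounded)
      show "(\<lambda>m. \<Sum>x\<in>F. (Rep_ell2 (X n) x - Rep_ell2 (X m) x)\<^sup>2)
          \<longlonglongrightarrow> (\<Sum>x\<in>F. (Rep_ell2 (X n) x - f x)\<^sup>2)"
        by (intro tendsto_intros f)
      show "\<forall>m\<ge>M. (\<Sum>x\<in>F. (Rep_ell2 (X n) x - Rep_ell2 (X m) x)\<^sup>2) \<le> e\<^sup>2"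
      proof (intro allI impI)
        fix m assume "M \<le> m"
        then have "(norm (X n - X m))\<^sup>2 \<le> e\<^sup>2"
          using M \<open>M \<le> n\<close> by (intro power_mono) (auto intro: less_imp_le)
        then show "(\<Sum>x\<in>F. (Rep_ell2 (X n) x - Rep_ell2 (X m) x)\<^sup>2) \<le> e\<^sup>2"
          using sum_square_le_ell2_norm[OF \<open>finite F\<close>, of "X n - X m"] by simp
      qed
    qed
    then show ?thesis by blast
  qed
  have diff: "(\<lambda>x. (Rep_ell2 (X n) x - f x)\<^sup>2) summable_on UNIV"
    if "\<forall>F. finite F \<longrightarrow> (\<Sum>x\<in>F. (Rep_ell2 (X n) x - f x)\<^sup>2) \<le> e\<^sup>2" for n e
    using that by (intro nonneg_bdd_above_summable_on) (auto intro!: bdd_aboveI)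
  obtain M where "\<forall>F. finite F \<longrightarrow> (\<Sum>x\<in>F. (Rep_ell2 (X M) x - f x)\<^sup>2) \<le> 1\<^sup>2"
    using tail[of 1] by auto
  then have "(\<lambda>x. (Rep_ell2 (X M) x + - (Rep_ell2 (X M) x - f x))\<^sup>2) summable_on UNIV"
    using diff[of M 1] by (intro summable_on_square_add Rep_ell2_square_summable) (auto simp: power2_commute)
  then have f_in: "f \<in> {f. (\<lambda>x. (f x)\<^sup>2) summable_on UNIV}" by simp
  have "X \<longlonglongrightarrow> Abs_ell2 f"
  proof (rule metric_LIMSEQ_I)
    fix e :: real assume "0 < e"
    then obtain M where M: "\<And>n F. M \<le> n \<Longrightarrow> finite F \<Longrightarrow>
        (\<Sum>x\<in>F. (Rep_ell2 (X n) x - f x)\<^sup>2) \<le> (e / 2)\<^sup>2"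
      using tail[of "e / 2"] by auto
    have "norm (X n - Abs_ell2 f) \<le> e / 2" if "M \<le> n" for n
    proof (rule power2_le_imp_le)
      show "(norm (X n - Abs_ell2 f))\<^sup>2 \<le> (e / 2)\<^sup>2"
        unfolding ell2_norm_square
        using M[OF that] diff[of n "e / 2"] f_in
        by (intro infsum_le_finite_sums) (auto simp: Abs_ell2_inverse Rep_ell2_square_summable)
    qed (use \<open>0 < e\<close> in simp)
    then show "\<exists>M. \<forall>n\<ge>M. dist (X n) (Abs_ell2 f) < e"
      using \<open>0 < e\<close> by (intro exI[of _ M]) (force simp: dist_norm intro: le_less_trans)
  qed
  then show "convergent X" by (auto simp: convergent_def)
qed

lift_definition ell2_delta :: "'a \<Rightarrow> 'a ell2" is "\<lambda>x y. of_bool (y = x)"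
  by (rule finite_nonzero_values_imp_summable_on) simp

lift_definition ell2_restrict :: "'a set \<Rightarrow> 'a ell2 \<Rightarrow> 'a ell2" is "\<lambda>A f x. if x \<in> A then f x else 0"
  by (rule summable_on_comparison_test) auto

definition ell2_reindex :: "('a \<Rightarrow> 'a) \<Rightarrow> 'a ell2 \<Rightarrow> 'a ell2" where
  "ell2_reindex \<pi> u = Abs_ell2 (Rep_ell2 u \<circ> \<pi>)"

lemma Rep_ell2_reindex:
  assumes "bij \<pi>"
  shows "Rep_ell2 (ell2_reindex \<pi> u) x = Rep_ell2 u (\<pi> x)"
proof -
  have "(\<lambda>x. (Rep_ell2 u (\<pi> x))\<^sup>2) summable_on UNIV"
    using summable_on_reindex_bij_betw[OF assms, of "\<lambda>x. (Rep_ell2 u x)\<^sup>2"]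
    by (simp add: Rep_ell2_square_summable)
  then show ?thesis by (simp add: ell2_reindex_def Abs_ell2_inverse)
qed

lemma ell2_eqI: "(\<And>x. Rep_ell2 u x = Rep_ell2 v x) \<Longrightarrow> u = v"
  by (simp add: Rep_ell2_inject[symmetric] fun_eq_iff)

lemma linear_ell2_reindex: "bij \<pi> \<Longrightarrow> linear (ell2_reindex \<pi>)"
  by (intro linearI ell2_eqI) (simp_all add: Rep_ell2_reindex)

lemma inner_ell2_reindex:
  "bij \<pi> \<Longrightarrow> inner (ell2_reindex \<pi> u) (ell2_reindex \<pi> v) = inner u v"
  using infsum_reindex_bij_betw[of \<pi> UNIV UNIV "\<lambda>x. Rep_ell2 u x * Rep_ell2 v x"]
  by (simp add: inner_ell2.rep_eq Rep_ell2_reindex)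

lemma inner_ell2_delta: "inner u (ell2_delta x) = Rep_ell2 u x"
proof -
  have "inner u (ell2_delta x) = (\<Sum>\<^sub>\<infinity>y\<in>{x}. Rep_ell2 u y)"
    unfolding inner_ell2.rep_eq ell2_delta.rep_eq by (rule infsum_cong_neutral) auto
  then show ?thesis by simp
qed

lemma bounded_linear_Rep_ell2: "bounded_linear (\<lambda>u. Rep_ell2 u x)"
  by (rule bounded_linear_intro[where K = 1]) (auto simp: abs_Rep_ell2_le_norm)

lemmas continuous_on_Rep_ell2 =
  bounded_linear.continuous_on[OF bounded_linear_Rep_ell2 continuous_on_id, simplified id_def]

section \<open>Orthogonal projections\<close>

definition orth_proj :: "('a :: real_inner \<Rightarrow> 'a) \<Rightarrow> bool" where
  "orth_proj P \<longleftrightarrow> linear P \<and> (\<forall>u. P (P u) = P u) \<and> (\<forall>u v. inner (P u) v = inner u (P v))"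

lemma orth_projD:
  assumes "orth_proj P"
  shows orth_proj_linear: "linear P"
    and orth_proj_idem: "P (P u) = P u"
    and orth_proj_sym: "inner (P u) v = inner u (P v)"
  using assms by (auto simp: orth_proj_def)

lemma orth_proj_norm_square:
  assumes "orth_proj P"
  shows "(norm (P u))\<^sup>2 = inner u (P u)"
  by (simp add: power2_norm_eq_inner orth_projD[OF assms])

lemma orth_proj_norm_diff_square:
  assumes "orth_proj P"
  shows "(norm (u - P u))\<^sup>2 = (norm u)\<^sup>2 - (norm (P u))\<^sup>2"
  unfolding power2_norm_eq_inner
  by (simp add: inner_diff_left inner_diff_right inner_commute orth_projD[OF assms])

lemma orth_proj_norm_le:
  assumes "orth_proj P"
  shows "norm (P u) \<le> norm u"
proof -
  have "0 \<le> (norm u)\<^sup>2 - (norm (P u))\<^sup>2"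
    unfolding orth_proj_norm_diff_square[OF assms, symmetric] by simp
  then show ?thesis by (simp add: abs_le_square_iff[symmetric])
qed

lemma orth_proj_eqI:
  assumes P: "orth_proj P" and v: "P v = v" and orth: "\<And>w. P w = w \<Longrightarrow> inner (u - v) w = 0"
  shows "P u = v"
proof -
  have "P (P u - v) = P u - v"
    using P v by (simp add: linear_diff orth_proj_linear orth_proj_idem)
  moreover from this have "inner (P u - v) (P u - v) = inner (u - v) (P u - v)"
    by (metis P v orth_proj_sym inner_diff_left)
  ultimately show ?thesis using orth by fastforce
qed

text \<open>
  By the parallelogram law two points of \<open>H\<close> whose distances to \<open>u\<close> are almost minimal are close to
  each other, because their midpoint is also in \<open>H\<close>. So a minimizing sequence is Cauchy.
\<close>

lemma ex_nearest_point:
  fixes H :: "'a :: {real_inner, complete_space} set"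
  assumes H: "subspace H" "closed H"
  shows "\<exists>p\<in>H. \<forall>h\<in>H. norm (u - p) \<le> norm (u - h)"
proof -
  define d where "d = (INF h\<in>H. (norm (u - h))\<^sup>2)"
  have ne: "H \<noteq> {}" using subspace_0[OF H(1)] by auto
  have bdd: "bdd_below ((\<lambda>h. (norm (u - h))\<^sup>2) ` H)" by (auto intro: bdd_belowI[of _ 0])
  have d_le: "d \<le> (norm (u - h))\<^sup>2" if "h \<in> H" for h
    unfolding d_def using that by (intro cINF_lower bdd)
  have "\<exists>h\<in>H. (norm (u - h))\<^sup>2 < d + 1 / Suc n" for n
    using cINF_less_iff[OF ne bdd, of "d + 1 / Suc n"] by (simp add: d_def)
  then obtain h where h: "h n \<in> H" "(norm (u - h n))\<^sup>2 < d + 1 / Suc n" for n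
    by metis
  have gap: "(norm (h m - h n))\<^sup>2 \<le> 2 / Suc m + 2 / Suc n" for m n
  proof -
    let ?c = "(1 / 2) *\<^sub>R (h m + h n)"
    have "?c \<in> H" using H h by (intro subspace_scale subspace_add) auto
    moreover have "(norm (h m - h n))\<^sup>2 =
        2 * (norm (u - h m))\<^sup>2 + 2 * (norm (u - h n))\<^sup>2 - 4 * (norm (u - ?c))\<^sup>2"
      unfolding power2_norm_eq_inner
      by (simp add: inner_diff_left inner_diff_right inner_add_left inner_add_right inner_commute
          algebra_simps)
    moreover have "2 / real (Suc k) = 2 * (1 / real (Suc k))" for k by simp
    ultimately show ?thesis using d_le[of ?c] h(2)[of m] h(2)[of n] by linarith
  qed
  have "Cauchy h"
  proof (rule metric_CauchyI)
    fix e :: real assume "0 < e"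
    then obtain N where N: "inverse (Suc N) < e\<^sup>2 / 4"
      using reals_Archimedean[of "e\<^sup>2 / 4"] by auto
    have "norm (h m - h n) < e" if "N \<le> m" "N \<le> n" for m n
    proof (rule power2_less_imp_less)
      have "2 / real (Suc m) \<le> 2 / Suc N" "2 / real (Suc n) \<le> 2 / Suc N"
        using that by (auto intro!: divide_left_mono)
      then show "(norm (h m - h n))\<^sup>2 < e\<^sup>2"
        using gap[of m n] N divide_inverse[of 2 "real (Suc N)"] by linarith
    qed (use \<open>0 < e\<close> in simp)
    then show "\<exists>M. \<forall>m\<ge>M. \<forall>n\<ge>M. dist (h m) (h n) < e" by (auto simp: dist_norm)
  qed
  then obtain p where p: "h \<longlonglongrightarrow> p" using Cauchy_convergent convergent_def by blast
  have "p \<in> H" using closed_sequentially[OF H(2) h(1) p] .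
  have "(\<lambda>n. d + 1 / Suc n) \<longlonglongrightarrow> d + 0"
    by (intro tendsto_intros LIMSEQ_Suc lim_1_over_n)
  moreover have "(\<lambda>n. (norm (u - h n))\<^sup>2) \<longlonglongrightarrow> (norm (u - p))\<^sup>2"
    by (intro tendsto_intros p)
  ultimately have "(norm (u - p))\<^sup>2 \<le> d"
    using h(2) by (auto intro: LIMSEQ_le less_imp_le)
  then have "norm (u - p) \<le> norm (u - h)" if "h \<in> H" for h
    using power2_le_imp_le[OF order_trans[OF _ d_le[OF that]]] by simp
  with \<open>p \<in> H\<close> show ?thesis by blast
qed

lemma ex_orth_proj:
  fixes H :: "'a :: {real_inner, complete_space} set"
  assumes H: "subspace H" "closed H"
  shows "\<exists>P. orth_proj P \<and> (\<forall>u. P u = u \<longleftrightarrow> u \<in> H)"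
proof -
  have "\<exists>p\<in>H. \<forall>h\<in>H. inner (u - p) h = 0" for u
  proof -
    obtain p where p: "p \<in> H" "\<forall>h\<in>H. norm (u - p) \<le> norm (u - h)"
      using ex_nearest_point[OF H] by blast
    have "inner (u - p) h = 0" if "h \<in> H" for h
    proof (cases "h = 0")
      case False
      \<comment> \<open>the value of \<open>s\<close> that minimizes the norm of \<open>u - p - s *\<^sub>R h\<close>\<close>
      define s where "s = inner (u - p) h / inner h h"
      have "p + s *\<^sub>R h \<in> H" using H p that by (intro subspace_scale subspace_add) auto
      then have "(norm (u - p))\<^sup>2 \<le> (norm (u - p - s *\<^sub>R h))\<^sup>2"
        using p by (intro power_mono) (auto simp: algebra_simps)
      also have "\<dots> = (norm (u - p))\<^sup>2 - 2 * s * inner (u - p) h + s\<^sup>2 * inner h h"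
        unfolding power2_norm_eq_inner inner_diff_left[of "u - p" "s *\<^sub>R h"]
          inner_diff_right[of _ "u - p" "s *\<^sub>R h"]
        by (simp add: inner_commute algebra_simps power2_eq_square)
      also have "\<dots> = (norm (u - p))\<^sup>2 - (inner (u - p) h)\<^sup>2 / inner h h"
        using False by (simp add: s_def power2_eq_square)
      finally have "(inner (u - p) h)\<^sup>2 / inner h h \<le> 0" by simp
      moreover have "0 < inner h h" using False by simp
      ultimately show ?thesis by (simp add: divide_le_0_iff)
    qed simp
    with p show ?thesis by blast
  qed
  then obtain P where P: "\<And>u. P u \<in> H" "\<And>u h. h \<in> H \<Longrightarrow> inner (u - P u) h = 0"
    by metis
  have eqI: "P u = v" if "v \<in> H" "\<And>h. h \<in> H \<Longrightarrow> inner (u - v) h = 0" for u v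
  proof -
    have "P u - v \<in> H" using H P that by (intro subspace_diff) auto
    then have "inner (u - v) (P u - v) - inner (u - P u) (P u - v) = 0" using P that by simp
    then have "inner (P u - v) (P u - v) = 0" by (simp add: inner_diff_left)
    then show ?thesis by simp
  qed
  have "orth_proj P"
    unfolding orth_proj_def
  proof (intro conjI allI)
    show "linear P"
    proof (rule linearI)
      show "P (u + v) = P u + P v" for u v
        using P(1) P(2)[of _ u] P(2)[of _ v] subspace_add[OF H(1)]
        by (intro eqI) (auto simp: inner_diff_left inner_add_left)
      show "P (r *\<^sub>R u) = r *\<^sub>R P u" for r u
        using P(1) P(2)[of _ u] subspace_scale[OF H(1)]
        by (intro eqI) (auto simp: inner_diff_left simp flip: right_diff_distrib)
    qed
    show "P (P u) = P u" for u by (rule eqI) (auto simp: P)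
    show "inner (P u) v = inner u (P v)" for u v
      using P(2)[OF P(1)[of v], of u] P(2)[OF P(1)[of u], of v]
      by (simp add: inner_diff_left inner_diff_right inner_commute)
  qed
  moreover have "P u = u \<longleftrightarrow> u \<in> H" for u
    using P(1)[of u] eqI[of u u] by auto
  ultimately show ?thesis by blast
qed

lemma orth_proj_ell2_restrict: "orth_proj (ell2_restrict A)"
  unfolding orth_proj_def
proof (intro conjI allI)
  show "linear (ell2_restrict A)" by (intro linearI ell2_eqI) (simp_all add: ell2_restrict.rep_eq)
  show "ell2_restrict A (ell2_restrict A u) = ell2_restrict A u" for u
    by (rule ell2_eqI) (simp add: ell2_restrict.rep_eq)
  show "inner (ell2_restrict A u) v = inner u (ell2_restrict A v)" for u v
    unfolding inner_ell2.rep_eq ell2_restrict.rep_eq by (rule infsum_cong) simp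
qed

lemma norm_square_ell2_restrict: "(norm (ell2_restrict A u))\<^sup>2 = (\<Sum>\<^sub>\<infinity>x\<in>A. (Rep_ell2 u x)\<^sup>2)"
  unfolding ell2_norm_square ell2_restrict.rep_eq by (rule infsum_cong_neutral) auto

lemma norm_square_ell2_restrict_Un:
  "A \<inter> B = {} \<Longrightarrow> (norm (ell2_restrict (A \<union> B) u))\<^sup>2 =
    (norm (ell2_restrict A u))\<^sup>2 + (norm (ell2_restrict B u))\<^sup>2"
  by (simp add: norm_square_ell2_restrict infsum_Un_disjoint Rep_ell2_square_summable)

lemma sum_norm_square_ell2_restrict_le:
  assumes "finite I" "disjoint_family_on A I"
  shows "(\<Sum>i\<in>I. (norm (ell2_restrict (A i) u))\<^sup>2) \<le> (norm u)\<^sup>2"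
proof -
  have "(\<Sum>i\<in>I. (norm (ell2_restrict (A i) u))\<^sup>2) = (norm (ell2_restrict (\<Union>i\<in>I. A i) u))\<^sup>2"
    using assms
  proof (induction I rule: finite_induct)
    case (insert i I)
    then have "A i \<inter> (\<Union>i\<in>I. A i) = {}" by (auto simp: disjoint_family_on_def)
    moreover have "disjoint_family_on A I"
      using insert.prems by (rule disjoint_family_on_mono[rotated]) auto
    ultimately show ?case using insert by (simp add: norm_square_ell2_restrict_Un)
  qed (simp add: norm_square_ell2_restrict)
  also have "\<dots> \<le> (norm u)\<^sup>2"
    by (intro power_mono orth_proj_norm_le orth_proj_ell2_restrict) simp
  finally show ?thesis .
qed

section \<open>Alternating projections\<close>

text \<open>
  Symmetry gives \<open>\<langle>T\<^sup>2\<^sup>m u, T\<^sup>2\<^sup>n u\<rangle> = \<parallel>T\<^sup>m\<^sup>+\<^sup>n u\<parallel>\<^sup>2\<close>, so the distances between even powers are differences of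
  the decreasing sequence \<open>\<parallel>T\<^sup>m u\<parallel>\<^sup>2\<close>. Odd powers are excluded because \<open>T\<close> may have the
  eigenvalue \<open>-1\<close>.
\<close>

lemma symmetric_contraction_even_powers_converge:
  fixes T :: "'a :: {real_inner, complete_space} \<Rightarrow> 'a"
  assumes lin: "linear T" and sym: "\<And>u v. inner (T u) v = inner u (T v)"
    and contr: "\<And>u. norm (T u) \<le> norm u"
  obtains v where "(\<lambda>m. (T ^^ (2 * m)) u) \<longlonglongrightarrow> v" and "T (T v) = v"
proof -
  define w where "w m = (T ^^ m) u" for m
  define c where "c m = (norm (w m))\<^sup>2" for m
  have w_Suc: "w (Suc m) = T (w m)" for m by (simp add: w_def)
  have shift: "inner (w (a + k)) (w b) = inner (w a) (w (b + k))" for a b k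
  proof (induction k arbitrary: b)
    case (Suc k)
    show ?case using Suc[of "Suc b"] by (simp add: w_Suc sym)
  qed simp
  have "decseq c"
    unfolding c_def w_Suc decseq_Suc_iff by (auto intro: power_mono contr)
  then obtain l where "c \<longlonglongrightarrow> l"
    using decseq_convergent[of c 0] by (auto simp: c_def)
  then have "Cauchy c" by (intro convergent_Cauchy) (auto simp: convergent_def)
  have dist_w: "(norm (w (2 * m) - w (2 * n)))\<^sup>2 = (c (2 * m) - c (m + n)) + (c (2 * n) - c (m + n))"
    for m n
  proof -
    have "inner (w (2 * m)) (w (2 * n)) = c (m + n)"
    proof (cases "m \<le> n")
      case True
      then show ?thesis
        using shift[of "2 * m" "n - m" "m + n"] by (simp add: c_def power2_norm_eq_inner mult_2)
    next
      case False
      then show ?thesis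
        using shift[of "m + n" "m - n" "2 * n"]
        by (simp add: c_def power2_norm_eq_inner mult_2 add.commute[of n m])
    qed
    then show ?thesis
      unfolding power2_norm_eq_inner
      by (simp add: inner_diff_left inner_diff_right inner_commute c_def power2_norm_eq_inner)
  qed
  have "Cauchy (\<lambda>m. w (2 * m))"
  proof (rule metric_CauchyI)
    fix e :: real assume "0 < e"
    then obtain M where M: "\<And>m n. M \<le> m \<Longrightarrow> M \<le> n \<Longrightarrow> \<bar>c m - c n\<bar> < e\<^sup>2 / 2"
      using metric_CauchyD[OF \<open>Cauchy c\<close>, of "e\<^sup>2 / 2"] by (auto simp: dist_real_def)
    have "norm (w (2 * m) - w (2 * n)) < e" if "M \<le> m" "M \<le> n" for m n
    proof (rule power2_less_imp_less)
      show "(norm (w (2 * m) - w (2 * n)))\<^sup>2 < e\<^sup>2"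
        using M[of "2 * m" "m + n"] M[of "2 * n" "m + n"] that unfolding dist_w by linarith
    qed (use \<open>0 < e\<close> in simp)
    then show "\<exists>M. \<forall>m\<ge>M. \<forall>n\<ge>M. dist (w (2 * m)) (w (2 * n)) < e" by (auto simp: dist_norm)
  qed
  then obtain v where v: "(\<lambda>m. w (2 * m)) \<longlonglongrightarrow> v" using Cauchy_convergent convergent_def by blast
  have bl: "bounded_linear T"
    using lin contr by (intro bounded_linear_intro[where K = 1]) (auto simp: linear_add linear_scale)
  have "(\<lambda>m. T (T (w (2 * m)))) \<longlonglongrightarrow> T (T v)"
    by (rule bounded_linear.tendsto[OF bl bounded_linear.tendsto[OF bl v]])
  moreover have "(\<lambda>m. T (T (w (2 * m)))) \<longlonglongrightarrow> v"
    using LIMSEQ_Suc[OF v] by (simp add: w_Suc)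
  ultimately have "T (T v) = v" by (rule LIMSEQ_unique)
  with v show ?thesis using that by (simp add: w_def)
qed

locale two_projections =
  fixes P E :: "'a :: real_inner \<Rightarrow> 'a"
  assumes P: "orth_proj P" and E: "orth_proj E"
begin

text \<open>
  With \<open>P\<close> on both sides the step is a symmetric operator on the whole space.
\<close>

definition compress :: "'a \<Rightarrow> 'a" where "compress v = P (P v - E (P v))"

definition iter :: "nat \<Rightarrow> 'a \<Rightarrow> 'a" where "iter m u = (compress ^^ m) (P u)"

lemma iter_0: "iter 0 u = P u" and iter_Suc: "iter (Suc m) u = compress (iter m u)"
  by (simp_all add: iter_def)

lemmas proj_simps = orth_proj_idem[OF P] orth_proj_idem[OF E]
  linear_diff[OF orth_proj_linear[OF P]] linear_diff[OF orth_proj_linear[OF E]]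

lemma P_iter: "P (iter m u) = iter m u"
  by (cases m) (simp_all add: iter_0 iter_Suc compress_def orth_proj_idem[OF P])

lemma linear_compress: "linear compress"
proof -
  have "linear (\<lambda>v. P (P v - E (P v)))"
    using orth_proj_linear[OF P] orth_proj_linear[OF E]
    by (auto intro!: linearI simp: linear_add linear_scale linear_diff algebra_simps)
  then show ?thesis by (simp add: compress_def[abs_def])
qed

lemma compress_sym: "inner (compress u) v = inner u (compress v)"
  by (simp add: compress_def proj_simps orth_proj_sym[OF P] orth_proj_sym[OF E]
      inner_diff_left inner_diff_right)

lemma norm_compress_le: "norm (compress v) \<le> norm v"
proof -
  have "(norm (P v - E (P v)))\<^sup>2 \<le> (norm (P v))\<^sup>2"
    by (simp add: orth_proj_norm_diff_square[OF E])
  then have "norm (P v - E (P v)) \<le> norm (P v)" by (rule power2_le_imp_le) simp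
  then show ?thesis
    using orth_proj_norm_le[OF P, of v] orth_proj_norm_le[OF P, of "P v - E (P v)"]
    by (simp add: compress_def)
qed

lemma iter_sym: "inner (iter m u) v = inner u (iter m v)"
proof (induction m arbitrary: v)
  case 0
  show ?case by (simp add: iter_0 orth_proj_sym[OF P])
next
  case (Suc m)
  have "P (compress v) = compress (P v)" by (simp add: compress_def proj_simps)
  then have "iter m (compress v) = iter (Suc m) v"
    by (simp add: iter_def funpow_swap1)
  then show ?case by (simp add: Suc iter_Suc compress_sym)
qed

lemma iter_commute:
  assumes "linear U" "\<And>u. P (U u) = U (P u)" "\<And>u. E (U u) = U (E u)"
  shows "iter m (U u) = U (iter m u)"
  by (induction m) (simp_all add: iter_0 iter_Suc compress_def assms flip: linear_diff[OF assms(1)])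

text \<open>
  On the range of \<open>P\<close> a step replaces \<open>v\<close> by \<open>v - P (E v)\<close>, and \<open>\<langle>v, P (E v)\<rangle> = \<parallel>E v\<parallel>\<^sup>2\<close> there.
\<close>

lemma energy_loss:
  "(norm (P u))\<^sup>2 - (norm (iter m u))\<^sup>2 \<le> 2 * (\<Sum>l<m. (norm (E (iter l u)))\<^sup>2)"
proof (induction m)
  case (Suc m)
  define v where "v = iter m u"
  have "compress v = v - P (E v)" by (simp add: compress_def proj_simps v_def P_iter)
  then have "(norm (compress v))\<^sup>2 = (norm v)\<^sup>2 - 2 * inner v (P (E v)) + (norm (P (E v)))\<^sup>2"
    unfolding power2_norm_eq_inner by (simp add: inner_diff_left inner_diff_right inner_commute)
  also have "inner v (P (E v)) = (norm (E v))\<^sup>2"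
    using orth_proj_sym[OF P, of v "E v"] by (simp add: v_def P_iter orth_proj_norm_square[OF E])
  finally have "(norm v)\<^sup>2 - (norm (compress v))\<^sup>2 \<le> 2 * (norm (E v))\<^sup>2" by simp
  with Suc show ?case by (simp add: iter_Suc v_def)
qed (simp add: iter_0)

text \<open>
  For \<open>w\<close> in the range of \<open>E\<close> the iterates are the images under \<open>P\<close> of the iterates
  \<open>z l = (E (1 - P) E)\<^sup>l w\<close> of the complementary pair. Passing from \<open>z l\<close> to \<open>z (l + 1)\<close> first removes the
  component \<open>P (z l)\<close>, so the squared norms of these components add up to at most that of \<open>w\<close>.
  Through this inequality the dimension of the range of \<open>E\<close> bounds that of the range of \<open>P\<close>.
\<close>

lemma energy_bound:
  assumes "E w = w"
  shows "(\<Sum>l<m. (norm (iter l w))\<^sup>2) \<le> (norm w)\<^sup>2"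
proof -
  define z where "z l = ((\<lambda>v. E (v - P v)) ^^ l) w" for l
  have z_Suc: "z (Suc l) = E (z l - P (z l))" for l by (simp add: z_def)
  have E_z: "E (z l) = z l" for l
    by (cases l) (simp_all add: z_Suc orth_proj_idem[OF E], simp add: z_def assms)
  have iter_z: "iter l w = P (z l)" for l
  proof (induction l)
    case (Suc l)
    have "compress (P (z l)) = P (z (Suc l))"
      using E_z[of l] by (simp add: compress_def z_Suc proj_simps)
    with Suc show ?case by (simp add: iter_Suc)
  qed (simp add: iter_0 z_def)
  have "(\<Sum>l<m. (norm (iter l w))\<^sup>2) \<le> (norm w)\<^sup>2 - (norm (z m))\<^sup>2"
  proof (induction m)
    case (Suc m)
    have "(norm (z (Suc m)))\<^sup>2 \<le> (norm (z m - P (z m)))\<^sup>2"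
      unfolding z_Suc by (intro power_mono orth_proj_norm_le[OF E]) simp
    then show ?case using Suc by (simp add: iter_z orth_proj_norm_diff_square[OF P])
  qed (simp add: z_def)
  then show ?thesis by (rule order_trans) simp
qed

end

text \<open>
  A vector \<open>v\<close> fixed by \<open>(P (1 - E) P)\<^sup>2\<close> loses no norm under \<open>P\<close> and \<open>1 - E\<close>, so it is fixed by both.
\<close>

lemma iter_tendsto_0:
  fixes P E :: "'a :: {real_inner, complete_space} \<Rightarrow> 'a"
  assumes "two_projections P E" and trivial: "\<And>v. P v = v \<Longrightarrow> E v = 0 \<Longrightarrow> v = 0"
  shows "(\<lambda>m. two_projections.iter P E (2 * m) u) \<longlonglongrightarrow> 0"
proof -
  interpret two_projections P E by fact
  obtain v where v: "(\<lambda>m. iter (2 * m) u) \<longlonglongrightarrow> v" "compress (compress v) = v"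
    using symmetric_contraction_even_powers_converge
      [OF linear_compress compress_sym norm_compress_le, of "P u"]
    unfolding iter_def by blast
  have "P v = v" using v(2) by (metis compress_def orth_proj_idem[OF P])
  have "norm v = norm (compress (compress v))" using v by simp
  also have "\<dots> \<le> norm (compress v)" by (rule norm_compress_le)
  also have "\<dots> \<le> norm (v - E v)"
    using orth_proj_norm_le[OF P] by (simp add: compress_def \<open>P v = v\<close>)
  finally have "(norm v)\<^sup>2 \<le> (norm (v - E v))\<^sup>2" by (intro power_mono) auto
  then have "E v = 0" by (simp add: orth_proj_norm_diff_square[OF E])
  with \<open>P v = v\<close> v show ?thesis using trivial by blast
qed

section \<open>Groups graded by the integers\<close>

locale graded_group = group G for G (structure) +
  fixes h :: "'a \<Rightarrow> int" and t :: 'a and K :: "'a set"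
  assumes h_mult: "x \<in> carrier G \<Longrightarrow> y \<in> carrier G \<Longrightarrow> h (x \<otimes> y) = h x + h y"
    and t [simp]: "t \<in> carrier G" and h_t: "h t = 1"
    and finite_K: "finite K" and K_carrier: "K \<subseteq> carrier G" and h_K: "s \<in> K \<Longrightarrow> h s = 0"
begin

lemma h_one: "h \<one> = 0"
  using h_mult[of \<one> \<one>] by simp

lemma h_inv: "x \<in> carrier G \<Longrightarrow> h (inv x) = - h x"
  using h_mult[of x "inv x"] by (simp add: h_one)

lemma h_pow: "h (t [^] (k :: nat)) = int k"
  by (induction k) (simp_all add: h_one h_mult h_t)

definition level :: "int \<Rightarrow> 'a set" where "level k = {x \<in> carrier G. h x = k}"

text \<open>
  For \<open>S = insert t K\<close> this is the equation \<open>\<Delta> u = \<nu> u\<close> multiplied by \<open>2 |S|\<close> and solved for the sum over the neighbours; so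
  \<open>c = 2 |S| (1 - \<nu>)\<close>.
\<close>

definition eigen :: "real \<Rightarrow> ('a \<Rightarrow> real) \<Rightarrow> bool" where
  "eigen c u \<longleftrightarrow> (\<forall>g\<in>carrier G. (\<Sum>s\<in>insert t K. u (g \<otimes> s) + u (g \<otimes> inv s)) = c * u g)"

text \<open>
  At a point whose level carries only zeros, all terms but those for \<open>t\<close> vanish. So a solution
  that vanishes on two consecutive levels vanishes on the next one in either direction.
\<close>

lemma eigen_vanishing_level:
  assumes "eigen c u" "g \<in> carrier G" "\<And>x. x \<in> carrier G \<Longrightarrow> h x = h g \<Longrightarrow> u x = 0"
  shows "u (g \<otimes> t) + u (g \<otimes> inv t) = 0"
proof -
  have "t \<notin> K" using h_K h_t by force
  moreover have "u (g \<otimes> s) + u (g \<otimes> inv s) = 0" if "s \<in> K" for s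
    using assms(2,3) that K_carrier by (simp add: subset_iff h_mult h_inv h_K)
  ultimately show ?thesis
    using assms finite_K by (force simp: eigen_def)
qed

lemma eigen_determined_by_two_levels:
  assumes u: "eigen c u" and zero: "\<And>x. x \<in> level 0 \<union> level 1 \<Longrightarrow> u x = 0"
    and x: "x \<in> carrier G"
  shows "u x = 0"
proof -
  have "u x = 0" if "x \<in> carrier G" "- int n \<le> h x" "h x \<le> int n + 1" for n x
    using that
  proof (induction n arbitrary: x)
    case 0
    then have "h x = 0 \<or> h x = 1" by auto
    then show ?case using 0 zero by (auto simp: level_def)
  next
    case (Suc n)
    consider "- int n \<le> h x" "h x \<le> int n + 1" | "h x = int n + 2" | "h x = - int n - 1"
      using Suc.prems by linarith
    then show ?case
    proof cases
      case 2
      have "u (x \<otimes> inv t \<otimes> t) + u (x \<otimes> inv t \<otimes> inv t) = 0"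
        using 2 Suc.prems(1) by (intro eigen_vanishing_level[OF u] Suc.IH) (auto simp: h_mult h_inv h_t)
      moreover have "u (x \<otimes> inv t \<otimes> inv t) = 0"
        using 2 Suc.prems(1) by (intro Suc.IH) (auto simp: h_mult h_inv h_t)
      ultimately show ?thesis using Suc.prems(1) by (simp add: m_assoc)
    next
      case 3
      have "u (x \<otimes> t \<otimes> t) + u (x \<otimes> t \<otimes> inv t) = 0"
        using 3 Suc.prems(1) by (intro eigen_vanishing_level[OF u] Suc.IH) (auto simp: h_mult h_inv h_t)
      moreover have "u (x \<otimes> t \<otimes> t) = 0"
        using 3 Suc.prems(1) by (intro Suc.IH) (auto simp: h_mult h_inv h_t)
      ultimately show ?thesis using Suc.prems(1) by (simp add: m_assoc)
    qed (use Suc in simp)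
  qed
  from this[of x "nat \<bar>h x\<bar>"] x show ?thesis by auto
qed

definition eigenspace :: "real \<Rightarrow> 'a ell2 set" where
  "eigenspace c = {u. (\<forall>x\<in>- carrier G. Rep_ell2 u x = 0) \<and> eigen c (Rep_ell2 u)}"

lemma subspace_eigenspace: "subspace (eigenspace c)"
proof (rule subspaceI)
  show "u + v \<in> eigenspace c" if "u \<in> eigenspace c" "v \<in> eigenspace c" for u v
    using that by (auto simp: eigenspace_def eigen_def sum.distrib algebra_simps)
  show "r *\<^sub>R u \<in> eigenspace c" if "u \<in> eigenspace c" for r u
    using that by (auto simp: eigenspace_def eigen_def simp flip: distrib_left sum_distrib_left)
qed (simp add: eigenspace_def eigen_def)

lemma closed_eigenspace: "closed (eigenspace c)"
proof -
  have "eigenspace c = (\<Inter>x\<in>- carrier G. {u. Rep_ell2 u x = 0}) \<inter>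
    (\<Inter>g\<in>carrier G. {u. (\<Sum>s\<in>insert t K. Rep_ell2 u (g \<otimes> s) + Rep_ell2 u (g \<otimes> inv s)) = c * Rep_ell2 u g})"
    by (auto simp: eigenspace_def eigen_def)
  also have "closed \<dots>"
    by (intro closed_Int closed_INT ballI closed_Collect_eq continuous_intros continuous_on_Rep_ell2)
  finally show ?thesis .
qed

section \<open>Left translations\<close>

text \<open>
  Points off the carrier are left fixed to make this a bijection of the whole type.
\<close>

definition shift :: "'a \<Rightarrow> 'a \<Rightarrow> 'a" where
  "shift g x = (if x \<in> carrier G then inv g \<otimes> x else x)"

definition transl :: "'a \<Rightarrow> 'a ell2 \<Rightarrow> 'a ell2" where "transl g = ell2_reindex (shift g)"

lemma bij_shift:
  assumes "g \<in> carrier G"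
  shows "bij (shift g)"
  using assms by (intro o_bij[of "shift (inv g)"]) (auto simp: shift_def fun_eq_iff m_assoc[symmetric])

lemma Rep_transl:
  "g \<in> carrier G \<Longrightarrow> Rep_ell2 (transl g u) x = Rep_ell2 u (shift g x)"
  by (simp add: transl_def Rep_ell2_reindex bij_shift)

lemma linear_transl: "g \<in> carrier G \<Longrightarrow> linear (transl g)"
  by (simp add: transl_def linear_ell2_reindex bij_shift)

lemma inner_transl: "g \<in> carrier G \<Longrightarrow> inner (transl g u) (transl g v) = inner u v"
  by (simp add: transl_def inner_ell2_reindex bij_shift)

lemma transl_delta:
  assumes "g \<in> carrier G" "x \<in> carrier G"
  shows "transl g (ell2_delta x) = ell2_delta (g \<otimes> x)"
proof (rule ell2_eqI)
  fix y
  have "shift g y = x \<longleftrightarrow> y = g \<otimes> x"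
    using assms by (auto simp: shift_def m_assoc[symmetric])
  then show "Rep_ell2 (transl g (ell2_delta x)) y = Rep_ell2 (ell2_delta (g \<otimes> x)) y"
    using assms by (simp add: Rep_transl ell2_delta.rep_eq)
qed

lemma transl_eigenspace:
  assumes "g \<in> carrier G" "u \<in> eigenspace c"
  shows "transl g u \<in> eigenspace c"
proof -
  have "(\<Sum>s\<in>insert t K. Rep_ell2 (transl g u) (x \<otimes> s) + Rep_ell2 (transl g u) (x \<otimes> inv s)) =
      c * Rep_ell2 (transl g u) x" if x: "x \<in> carrier G" for x
  proof -
    have "(\<Sum>s\<in>insert t K. Rep_ell2 (transl g u) (x \<otimes> s) + Rep_ell2 (transl g u) (x \<otimes> inv s)) =
        (\<Sum>s\<in>insert t K. Rep_ell2 u (inv g \<otimes> x \<otimes> s) + Rep_ell2 u (inv g \<otimes> x \<otimes> inv s))"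
      using assms(1) x K_carrier
      by (intro sum.cong) (auto simp: Rep_transl shift_def m_assoc)
    also have "\<dots> = c * Rep_ell2 u (inv g \<otimes> x)"
      using assms x unfolding eigenspace_def eigen_def by blast
    finally show ?thesis using assms(1) x by (simp add: Rep_transl shift_def)
  qed
  then show ?thesis
    using assms by (simp add: eigenspace_def eigen_def Rep_transl shift_def)
qed

text \<open>
  Translations preserve the eigenspace and, as invertible isometries, its orthogonal complement.
\<close>

lemma orth_proj_commutes_transl:
  assumes P: "orth_proj P" "\<And>u. P u = u \<longleftrightarrow> u \<in> eigenspace c" and g: "g \<in> carrier G"
  shows "P (transl g u) = transl g (P u)"
proof (rule orth_proj_eqI[OF P(1)])
  show "P (transl g (P u)) = transl g (P u)"
    using P transl_eigenspace[OF g] orth_proj_idem[OF P(1)] by simp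
  fix w assume "P w = w"
  define w' where "w' = transl (inv g) w"
  have "P w' = w'" using \<open>P w = w\<close> P(2) transl_eigenspace[of "inv g"] g by (simp add: w'_def)
  have "w = transl g w'"
    using g by (intro ell2_eqI) (auto simp: w'_def Rep_transl shift_def m_assoc[symmetric])
  then have "inner (transl g u - transl g (P u)) w = inner (u - P u) w'"
    using g by (simp add: inner_transl flip: linear_diff[OF linear_transl])
  also have "\<dots> = 0"
    using orth_proj_sym[OF P(1), of u w'] \<open>P w' = w'\<close> by (simp add: inner_diff_left)
  finally show "inner (transl g u - transl g (P u)) w = 0" .
qed

text \<open>
  An operator \<open>D\<close> as below has a symmetric matrix that is invariant under the diagonal
  action of the level \<open>0\<close>, the kernel of \<open>h\<close>. Up to this action, the entries with row \<open>x\<close> and column on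
  level \<open>j\<close> are therefore those with row \<open>y\<close> and column on level \<open>i\<close>: for \<open>z\<close> on level \<open>j\<close>,
  translating the pair \<open>(x, z)\<close> by \<open>y z\<^sup>-\<^sup>1\<close> gives the pair \<open>(y z\<^sup>-\<^sup>1 x, y)\<close>. With \<open>E\<^sub>k\<close> the
  restriction to level \<open>k\<close>, this is \<open>tr (E\<^sub>i D E\<^sub>j D E\<^sub>i) = tr (E\<^sub>j D E\<^sub>i D E\<^sub>j)\<close> for the trace over the kernel.
\<close>

lemma level_transport:
  assumes sym: "\<And>u v. inner (D u) v = inner u (D v)"
    and equiv: "\<And>g u. g \<in> level 0 \<Longrightarrow> D (transl g u) = transl g (D u)"
    and x: "x \<in> level i" and y: "y \<in> level j"
  shows "norm (ell2_restrict (level j) (D (ell2_delta x))) =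
    norm (ell2_restrict (level i) (D (ell2_delta y)))"
proof -
  have bij: "bij_betw (\<lambda>z. y \<otimes> inv z \<otimes> x) (level j) (level i)"
    using x y
    by (intro bij_betw_byWitness[where f' = "\<lambda>z. x \<otimes> inv z \<otimes> y"])
       (auto simp: level_def h_mult h_inv inv_mult_group m_assoc[symmetric], auto simp: m_assoc)
  have "Rep_ell2 (D (ell2_delta x)) z = Rep_ell2 (D (ell2_delta y)) (y \<otimes> inv z \<otimes> x)"
    if "z \<in> level j" for z
  proof -
    define g where "g = y \<otimes> inv z"
    have g: "g \<in> level 0" "g \<otimes> z = y" "g \<in> carrier G" and z: "z \<in> carrier G" "x \<in> carrier G"
      using x y that by (auto simp: level_def g_def h_mult h_inv m_assoc)
    have "Rep_ell2 (D (ell2_delta x)) z = inner (transl g (D (ell2_delta x))) (transl g (ell2_delta z))"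
      using g by (simp add: inner_transl inner_ell2_delta)
    also have "\<dots> = inner (D (ell2_delta (g \<otimes> x))) (ell2_delta y)"
      using g z by (simp add: transl_delta flip: equiv)
    also have "\<dots> = inner (ell2_delta (g \<otimes> x)) (D (ell2_delta y))" by (rule sym)
    also have "\<dots> = Rep_ell2 (D (ell2_delta y)) (g \<otimes> x)"
      by (subst inner_commute) (rule inner_ell2_delta)
    finally show ?thesis by (simp add: g_def)
  qed
  then have "(norm (ell2_restrict (level j) (D (ell2_delta x))))\<^sup>2 =
      (\<Sum>\<^sub>\<infinity>z\<in>level j. (Rep_ell2 (D (ell2_delta y)) (y \<otimes> inv z \<otimes> x))\<^sup>2)"
    unfolding norm_square_ell2_restrict by (intro infsum_cong) simp
  also have "\<dots> = (norm (ell2_restrict (level i) (D (ell2_delta y))))\<^sup>2"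
    unfolding norm_square_ell2_restrict by (rule infsum_reindex_bij_betw[OF bij])
  finally show ?thesis by simp
qed

section \<open>Vanishing of the eigenspaces\<close>

theorem eigenspace_trivial: "eigenspace c = {0}"
proof -
  obtain P where proj: "orth_proj P" "\<And>u. P u = u \<longleftrightarrow> u \<in> eigenspace c"
    using ex_orth_proj[OF subspace_eigenspace closed_eigenspace] by metis
  define L where "L = level 0 \<union> level 1"
  interpret two_projections P "ell2_restrict L"
    by unfold_locales (fact proj orth_proj_ell2_restrict)+
  define x where "x k = t [^] (k :: nat)" for k
  define e where "e k = ell2_delta (x k)" for k
  have x: "x k \<in> level (int k)" for k by (simp add: x_def level_def h_pow)
  have P_delta: "norm (P (ell2_delta g)) = norm (P (ell2_delta \<one>))" if "g \<in> carrier G" for g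
    using that orth_proj_commutes_transl[OF proj that, of "ell2_delta \<one>"]
    by (simp add: norm_eq_sqrt_inner inner_transl transl_delta)
  have equiv: "iter l (transl g u) = transl g (iter l u)" if "g \<in> level 0" for l g u
  proof (rule iter_commute)
    have g: "g \<in> carrier G" using that by (simp add: level_def)
    show "linear (transl g)" "\<And>u. P (transl g u) = transl g (P u)"
      using orth_proj_commutes_transl[OF proj g] by (auto simp: linear_transl g)
    have "shift g y \<in> L \<longleftrightarrow> y \<in> L" for y
      using that g by (auto simp: L_def level_def shift_def h_mult h_inv)
    then show "ell2_restrict L (transl g u) = transl g (ell2_restrict L u)" for u
      by (intro ell2_eqI) (simp add: ell2_restrict.rep_eq Rep_transl g)
  qed
  have swap: "norm (ell2_restrict (level (int b)) (iter l (e k))) =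
      norm (ell2_restrict (level (int k)) (iter l (e b)))" for b k l
    unfolding e_def by (rule level_transport[OF iter_sym equiv x x])
  have disj: "disjoint_family_on (\<lambda>k. level (int k)) I" for I
    by (auto simp: disjoint_family_on_def level_def)
  have restrict_L: "(norm (ell2_restrict L u))\<^sup>2 =
      (\<Sum>b\<le>1. (norm (ell2_restrict (level (int b)) u))\<^sup>2)" for u
    unfolding L_def by (subst norm_square_ell2_restrict_Un) (auto simp: level_def)
  \<comment> \<open>By \<open>swap\<close>, the mass that reaches the levels \<open>0\<close> and \<open>1\<close> from the points \<open>x k\<close> is the mass that the
      two points \<open>x 0\<close> and \<open>x 1\<close> send to the distinct levels \<open>k\<close>.\<close>
  have leak: "(\<Sum>k<n. (norm (ell2_restrict L (iter l (e k))))\<^sup>2) \<le> (\<Sum>b\<le>1. (norm (iter l (e b)))\<^sup>2)" for n l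
  proof -
    have "(\<Sum>k<n. (norm (ell2_restrict L (iter l (e k))))\<^sup>2) =
        (\<Sum>b\<le>1. \<Sum>k<n. (norm (ell2_restrict (level (int k)) (iter l (e b))))\<^sup>2)"
      unfolding restrict_L
      by (subst sum.swap) (intro sum.cong refl arg_cong[where f = "\<lambda>r. r\<^sup>2"] swap)
    also have "\<dots> \<le> (\<Sum>b\<le>1. (norm (iter l (e b)))\<^sup>2)"
      by (intro sum_mono sum_norm_square_ell2_restrict_le disj) simp
    finally show ?thesis .
  qed
  have e_L: "ell2_restrict L (e b) = e b" and norm_e: "norm (e b) = 1" if "b \<le> 1" for b
  proof -
    have "x b \<in> L" using x[of b] that by (cases b) (auto simp: L_def)
    then show "ell2_restrict L (e b) = e b"
      by (intro ell2_eqI) (auto simp: e_def ell2_restrict.rep_eq ell2_delta.rep_eq)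
    show "norm (e b) = 1"
      by (simp add: norm_eq_sqrt_inner e_def inner_ell2_delta ell2_delta.rep_eq)
  qed
  \<comment> \<open>the dimension of the eigenspace over the whole group\<close>
  define d where "d = (norm (P (ell2_delta \<one>)))\<^sup>2"
  have norm_P_e: "(norm (P (e k)))\<^sup>2 = d" for k
    using P_delta[of "x k"] x[of k] by (simp add: d_def e_def level_def)
  have bound: "real n * d - (\<Sum>k<n. (norm (iter m (e k)))\<^sup>2) \<le> 4" for n m
  proof -
    have "real n * d - (\<Sum>k<n. (norm (iter m (e k)))\<^sup>2) =
        (\<Sum>k<n. (norm (P (e k)))\<^sup>2 - (norm (iter m (e k)))\<^sup>2)"
      by (simp add: sum_subtractf norm_P_e)
    also have "\<dots> \<le> (\<Sum>k<n. 2 * (\<Sum>l<m. (norm (ell2_restrict L (iter l (e k))))\<^sup>2))"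
      by (intro sum_mono energy_loss)
    also have "\<dots> = 2 * (\<Sum>l<m. \<Sum>k<n. (norm (ell2_restrict L (iter l (e k))))\<^sup>2)"
      unfolding sum_distrib_left[symmetric] by (subst sum.swap) (rule refl)
    also have "\<dots> \<le> 2 * (\<Sum>l<m. \<Sum>b\<le>1. (norm (iter l (e b)))\<^sup>2)"
      by (intro mult_left_mono sum_mono leak) simp
    also have "\<dots> = 2 * (\<Sum>b\<le>1. \<Sum>l<m. (norm (iter l (e b)))\<^sup>2)"
      by (subst sum.swap) (rule refl)
    also have "\<dots> \<le> 2 * (\<Sum>b\<le>(1 :: nat). 1)"
      using energy_bound[OF e_L] norm_e by (intro mult_left_mono sum_mono) auto
    finally show ?thesis by simp
  qed
  have trivial: "v = 0" if "P v = v" "ell2_restrict L v = 0" for v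
  proof (rule ell2_eqI)
    fix y
    have v: "v \<in> eigenspace c" using that proj by simp
    have zero: "Rep_ell2 v z = 0" if "z \<in> L" for z
      using that \<open>ell2_restrict L v = 0\<close> by (metis ell2_restrict.rep_eq zero_ell2.rep_eq)
    have "Rep_ell2 v y = 0" if "y \<in> carrier G"
      by (rule eigen_determined_by_two_levels[OF _ zero that])
         (use v in \<open>auto simp: eigenspace_def L_def\<close>)
    then show "Rep_ell2 v y = Rep_ell2 0 y" using v by (auto simp: eigenspace_def)
  qed
  have "real n * d \<le> 4" for n
  proof (rule LIMSEQ_le_const2)
    have "(\<lambda>m. iter (2 * m) u) \<longlonglongrightarrow> 0" for u
      by (rule iter_tendsto_0[OF two_projections_axioms trivial])
    then have "(\<lambda>m. real n * d - (\<Sum>k<n. (norm (iter (2 * m) (e k)))\<^sup>2)) \<longlonglongrightarrow>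
        real n * d - (\<Sum>k<n. (norm (0 :: 'a ell2))\<^sup>2)"
      by (intro tendsto_intros)
    then show "(\<lambda>m. real n * d - (\<Sum>k<n. (norm (iter (2 * m) (e k)))\<^sup>2)) \<longlonglongrightarrow> real n * d"
      by simp
    show "\<exists>N. \<forall>m\<ge>N. real n * d - (\<Sum>k<n. (norm (iter (2 * m) (e k)))\<^sup>2) \<le> 4"
      using bound by blast
  qed
  then have "\<not> 0 < d" using reals_Archimedean3[of d] by (meson not_less)
  then have "d = 0" by (simp add: d_def)
  then have P0: "P (ell2_delta g) = 0" if "g \<in> carrier G" for g
    using P_delta[OF that] by (simp add: d_def)
  have "u = 0" if u: "u \<in> eigenspace c" for u
  proof (rule ell2_eqI)
    fix y
    have "P u = u" using proj(2) u by blast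
    then have "Rep_ell2 u y = inner (P u) (ell2_delta y)" by (simp add: inner_ell2_delta)
    also have "\<dots> = inner u (P (ell2_delta y))" by (rule orth_proj_sym[OF P])
    finally have "Rep_ell2 u y = 0" if "y \<in> carrier G" using that P0 by simp
    then show "Rep_ell2 u y = Rep_ell2 0 y" using u by (auto simp: eigenspace_def)
  qed
  then show ?thesis using subspace_0[OF subspace_eigenspace] by auto
qed

corollary eigen_square_summable_zero:
  assumes "eigen c u" "(\<lambda>x. (u x)\<^sup>2) summable_on carrier G" "x \<in> carrier G"
  shows "u x = 0"
proof -
  define f where "f y = (if y \<in> carrier G then u y else 0)" for y
  have "(\<lambda>y. (f y)\<^sup>2) summable_on UNIV"
    using assms(2) by (rule summable_on_cong_neutral[THEN iffD1, rotated -1]) (auto simp: f_def)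
  then have Rep: "Rep_ell2 (Abs_ell2 f) = f" by (simp add: Abs_ell2_inverse)
  have "(\<Sum>s\<in>insert t K. f (g \<otimes> s) + f (g \<otimes> inv s)) = c * f g" if g: "g \<in> carrier G" for g
  proof -
    have "(\<Sum>s\<in>insert t K. f (g \<otimes> s) + f (g \<otimes> inv s)) =
        (\<Sum>s\<in>insert t K. u (g \<otimes> s) + u (g \<otimes> inv s))"
      using g K_carrier by (intro sum.cong) (auto simp: f_def)
    also have "\<dots> = c * f g" using assms(1) g by (simp add: eigen_def f_def)
    finally show ?thesis .
  qed
  then have "Abs_ell2 f \<in> eigenspace c"
    by (simp add: eigenspace_def eigen_def Rep) (simp add: f_def)
  then have "f x = 0" using Rep eigenspace_trivial[of c] by (metis singletonD zero_ell2.rep_eq)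
  then show ?thesis using assms(3) by (simp add: f_def)
qed

end

lemma graded_no_laplace_eigenfunction:
  assumes "graded_group G h t K" "S = insert t K"
  shows "\<not> laplace_eigenfunction (cayley_graph G S) \<nu> \<phi>"
proof
  assume \<phi>: "laplace_eigenfunction (cayley_graph G S) \<nu> \<phi>"
  interpret graded_group G h t K by fact
  define c where "c = 2 * real (card S) * (1 - \<nu>)"
  have S: "finite S" "S \<subseteq> carrier G" "card S \<noteq> 0"
    using finite_K K_carrier assms(2) by auto
  have verts: "verts (cayley_graph G S) = carrier G" by (simp add: cayley_graph_def)
  have eq: "(\<Sum>s\<in>S. \<phi> (g \<otimes>\<^bsub>G\<^esub> s) + \<phi> (g \<otimes>\<^bsub>G\<^esub> inv\<^bsub>G\<^esub> s)) = of_real c * \<phi> g"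
    if "g \<in> carrier G" for g
  proof -
    have "laplacian (cayley_graph G S) \<phi> g = of_real \<nu> * \<phi> g"
      using \<phi> that by (simp add: laplace_eigenfunction_def verts)
    then show ?thesis
      using S(3) unfolding laplacian_cayley_graph[OF is_group S(1,2) that]
      by (simp add: c_def field_simps)
  qed
  have "eigen c (\<lambda>x. Re (\<phi> x))" "eigen c (\<lambda>x. Im (\<phi> x))"
    unfolding eigen_def
    using arg_cong[OF eq, of _ Re] arg_cong[OF eq, of _ Im] by (auto simp: assms(2))
  moreover have "(\<lambda>x. (Re (\<phi> x))\<^sup>2) summable_on carrier G" "(\<lambda>x. (Im (\<phi> x))\<^sup>2) summable_on carrier G"
    using \<phi> unfolding laplace_eigenfunction_def square_summable_on_def verts
    by (auto intro: summable_on_comparison_test simp: cmod_power2)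
  ultimately have "\<phi> x = 0" if "x \<in> carrier G" for x
    using eigen_square_summable_zero[of c "\<lambda>x. Re (\<phi> x)" x]
      eigen_square_summable_zero[of c "\<lambda>x. Im (\<phi> x)" x] that
    by (simp add: complex_eq_iff)
  then show False using \<phi> by (auto simp: laplace_eigenfunction_def verts)
qed

theorem theorem1p1:
  fixes G :: "('a, 'm) monoid_scheme"
    and h :: "'a \<Rightarrow> int"
    and t :: 'a
    and K S :: "'a set"
  assumes "group G"
    and "h \<in> epi G integer_group"
    and "finite S"
    and "S \<subseteq> carrier G"
    and "generate G S = carrier G"
    and "S = {t} \<union> K"
    and "generate integer_group {h t} = carrier integer_group"
    and "K \<subseteq> kernel G integer_group h"
  shows "\<not> (\<exists>\<nu> \<phi>. laplace_eigenfunction (cayley_graph G S) \<nu> \<phi> \<and>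
            finite {x \<in> carrier G. \<phi> x \<noteq> 0}) \<and>
    (amenable G \<longrightarrow> \<not> (\<exists>\<nu> \<phi>. laplace_eigenfunction (cayley_graph G S) \<nu> \<phi>))"
proof -
  interpret group G by fact
  have "1 \<in> generate integer_group {h t}" using assms(7) by simp
  then obtain k :: int where "k * h t = 1"
    using group.generate_pow[OF group_integer_group, of "h t"] by auto
  then have "h t * h t = 1" by (auto simp: zmult_eq_1_iff)
  \<comment> \<open>\<open>h t\<close> is \<open>1\<close> or \<open>-1\<close>; multiplying \<open>h\<close> by it makes \<open>t\<close> raise the level\<close>
  then have "graded_group G (\<lambda>x. h t * h x) t K"
    using assms
    by unfold_locales (auto simp: epi_def hom_def kernel_def distrib_left)
  then show ?thesis using graded_no_laplace_eigenfunction[of G _ t K S] assms(6) by auto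
qed

end
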